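(* Let $\mathcal H$ be a Hilbert space, let $e\in\mathcal B(\mathcal H)$ be an orthogonal projection and let $u\in\mathcal B(\mathcal H)$ be a hermitian involution such that $\|eue\|<1$. Let $\mathcal Q_u$ be the set of all orthogonal projections $q\in\mathcal B(\mathcal H)$ with $quq=0$, and let $\mathcal W(e,u)$ be the $W^*$-algebra generated by $e$ and $u$. Then the distance from $e$ to $\mathcal Q_u\cap\mathcal W(e,u)$ is attained at an element lying in the $C^*$-algebra $\mathcal C(e,ueu^* )$ generated by $e$ and $ueu^*$; that is, there exists $q_0\in\mathcal Q_u\cap\mathcal W(e,u)$ such that $q_0\in\mathcal C(e,ueu^* )$ and \[ \|e-q_0\|=\inf\{\|e-q\| : q\in\mathcal Q_u\cap\mathcal W(e,u)\}. \]
   Context: $\mathcal B(\mathcal H)$ is the $C^*$-algebra of all bounded linear operators on the (complex) Hilbert space $\mathcal H$, with the operator norm $\|\cdot\|$. A hermitian involution is an operator $u\in\mathcal B(\mathcal H)$ with $u=u^*$ and $u^2=I$. An orthogonal projection is an operator $q$ with $q=q^*=q^2$. $\mathcal W(e,u)$ is the smallest $W^*$-algebra (von Neumann algebra, i.e. weakly closed $*$-subalgebra of $\mathcal B(\mathcal H)$; it contains $I=u^2$) containing $e$ and $u$. $\mathcal C(e,ueu^* )$ is the smallest $C^*$-subalgebra (norm-closed $*$-subalgebra) of $\mathcal B(\mathcal H)$ containing $e$ and $ueu^*$. *)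

theory Defs
  imports "HOL-Analysis.Analysis"
begin

section \<open>Complex Hilbert spaces\<close>

text \<open>
  The inner product is linear in the first argument and conjugate-linear in the second.
  The axiom \<open>cinner_self\<close> says that it is positive definite and induces the norm.
\<close>

class complex_inner = real_normed_vector +
  fixes scaleC :: "complex \<Rightarrow> 'a \<Rightarrow> 'a" (infixr \<open>*\<^sub>C\<close> 75)
    and cinner :: "'a \<Rightarrow> 'a \<Rightarrow> complex"
  assumes scaleC_add_right: "a *\<^sub>C (x + y) = a *\<^sub>C x + a *\<^sub>C y"
    and scaleC_add_left: "(a + b) *\<^sub>C x = a *\<^sub>C x + b *\<^sub>C x"
    and scaleC_scaleC: "a *\<^sub>C (b *\<^sub>C x) = (a * b) *\<^sub>C x"
    and scaleC_of_real: "complex_of_real r *\<^sub>C x = r *\<^sub>R x"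
    and cinner_commute: "cinner x y = cnj (cinner y x)"
    and cinner_add_left: "cinner (x + y) z = cinner x z + cinner y z"
    and cinner_scaleC_left: "cinner (a *\<^sub>C x) y = a * cinner x y"
    and cinner_self: "cinner x x = complex_of_real ((norm x)\<^sup>2)"

class chilbert_space = complex_inner + complete_space

section \<open>Bounded complex-linear operators\<close>

text \<open>
  The library type of bounded linear maps consists of the real-linear ones; its norm is the
  operator norm.  The algebra of all bounded operators is the set of its complex-linear elements.
\<close>

definition BH :: "('a::complex_inner \<Rightarrow>\<^sub>L 'a) set"
  where "BH = {A. \<forall>c x. blinfun_apply A (c *\<^sub>C x) = c *\<^sub>C blinfun_apply A x}"

definition scaleC_op :: "complex \<Rightarrow> ('a::complex_inner \<Rightarrow>\<^sub>L 'a) \<Rightarrow> ('a \<Rightarrow>\<^sub>L 'a)"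
  where "scaleC_op c A = Blinfun (\<lambda>x. c *\<^sub>C blinfun_apply A x)"

text \<open>
  Existence and uniqueness of the adjoint on a Hilbert space, and boundedness of the map in
  \<open>scaleC_op\<close>, are proved at the end of this theory.
\<close>

definition adj :: "('a::chilbert_space \<Rightarrow>\<^sub>L 'a) \<Rightarrow> ('a \<Rightarrow>\<^sub>L 'a)"
  where "adj A = (THE B. B \<in> BH \<and>
    (\<forall>x y. cinner (blinfun_apply A x) y = cinner x (blinfun_apply B y)))"

definition hermitian_involution :: "('a::chilbert_space \<Rightarrow>\<^sub>L 'a) \<Rightarrow> bool"
  where "hermitian_involution u \<longleftrightarrow> u \<in> BH \<and> adj u = u \<and> u o\<^sub>L u = id_blinfun"

definition orthogonal_projection :: "('a::chilbert_space \<Rightarrow>\<^sub>L 'a) \<Rightarrow> bool"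
  where "orthogonal_projection q \<longleftrightarrow> q \<in> BH \<and> adj q = q \<and> q o\<^sub>L q = q"

section \<open>Operator algebras\<close>

definition star_subalgebra :: "('a::chilbert_space \<Rightarrow>\<^sub>L 'a) set \<Rightarrow> bool"
  where "star_subalgebra S \<longleftrightarrow> S \<subseteq> BH \<and> 0 \<in> S \<and>
    (\<forall>A\<in>S. \<forall>B\<in>S. A + B \<in> S) \<and>
    (\<forall>c. \<forall>A\<in>S. scaleC_op c A \<in> S) \<and>
    (\<forall>A\<in>S. \<forall>B\<in>S. A o\<^sub>L B \<in> S) \<and>
    (\<forall>A\<in>S. adj A \<in> S)"

text \<open>
  The weak operator topology: the initial topology on \<^const>\<open>BH\<close> for the maps
  \<open>A \<mapsto> \<langle>A x, y\<rangle>\<close>.  The topology on the function space is the product topology.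
\<close>

definition weak_operator_topology :: "('a::chilbert_space \<Rightarrow>\<^sub>L 'a) topology"
  where "weak_operator_topology =
    pullback_topology BH (\<lambda>A (x, y). cinner (blinfun_apply A x) y)
      (euclidean :: ('a \<times> 'a \<Rightarrow> complex) topology)"

definition C_star_subalgebra :: "('a::chilbert_space \<Rightarrow>\<^sub>L 'a) set \<Rightarrow> bool"
  where "C_star_subalgebra S \<longleftrightarrow> star_subalgebra S \<and> closed S"

definition W_star_subalgebra :: "('a::chilbert_space \<Rightarrow>\<^sub>L 'a) set \<Rightarrow> bool"
  where "W_star_subalgebra S \<longleftrightarrow> star_subalgebra S \<and> closedin weak_operator_topology S"

definition C_star_generated :: "('a::chilbert_space \<Rightarrow>\<^sub>L 'a) set \<Rightarrow> ('a \<Rightarrow>\<^sub>L 'a) set"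
  where "C_star_generated X = C_star_subalgebra hull X"

definition W_star_generated :: "('a::chilbert_space \<Rightarrow>\<^sub>L 'a) set \<Rightarrow> ('a \<Rightarrow>\<^sub>L 'a) set"
  where "W_star_generated X = W_star_subalgebra hull X"

definition Q_set :: "('a::chilbert_space \<Rightarrow>\<^sub>L 'a) \<Rightarrow> ('a \<Rightarrow>\<^sub>L 'a) set"
  where "Q_set u = {q. orthogonal_projection q \<and> q o\<^sub>L u o\<^sub>L q = 0}"

section \<open>Existence and uniqueness of adjoints\<close>

lemma cinner_add_right: "cinner x (y + z) = cinner x y + cinner x (z::'a::complex_inner)"
  by (metis cinner_add_left cinner_commute complex_cnj_add)

lemma cinner_scaleC_right: "cinner x (a *\<^sub>C y) = cnj a * cinner x (y::'a::complex_inner)"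
  by (metis cinner_commute cinner_scaleC_left complex_cnj_mult)

lemma cinner_scaleR_left: "cinner (r *\<^sub>R x) y = of_real r * cinner x (y::'a::complex_inner)"
  by (metis cinner_scaleC_left scaleC_of_real)

lemma cinner_scaleR_right: "cinner x (r *\<^sub>R y) = of_real r * cinner x (y::'a::complex_inner)"
  by (metis cinner_scaleC_right scaleC_of_real complex_cnj_complex_of_real)

lemma cinner_diff_right: "cinner x (y - z) = cinner x y - cinner x (z::'a::complex_inner)"
  by (metis cinner_add_right add_diff_cancel diff_add_cancel)

lemma norm_add_square:
  "(norm (x + y))\<^sup>2 = (norm x)\<^sup>2 + 2 * Re (cinner x y) + (norm (y::'a::complex_inner))\<^sup>2"
proof -
  have n: "(norm z)\<^sup>2 = Re (cinner z z)" for z :: 'a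
    by (simp add: cinner_self)
  have "Re (cinner y x) = Re (cinner x y)"
    by (metis cinner_commute complex_cnj(1) complex.sel(1) complex_surj)
  then show ?thesis
    by (simp add: n cinner_add_left cinner_add_right)
qed

lemma norm_scaleC: "norm (a *\<^sub>C x) = norm a * norm (x::'a::complex_inner)"
proof -
  have "complex_of_real ((norm (a *\<^sub>C x))\<^sup>2) = (a * cnj a) * cinner x x"
    unfolding cinner_self[symmetric] cinner_scaleC_left cinner_scaleC_right
    by (simp only: mult_ac)
  also have "\<dots> = complex_of_real ((norm a * norm x)\<^sup>2)"
    unfolding cinner_self by (simp add: complex_norm_square[symmetric] power_mult_distrib)
  finally have "(norm (a *\<^sub>C x))\<^sup>2 = (norm a * norm x)\<^sup>2"
    using of_real_eq_iff by blast
  then show ?thesis by simp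
qed

lemma bounded_linear_scaleC: "bounded_linear (\<lambda>x::'a::complex_inner. c *\<^sub>C x)"
proof (rule bounded_linear_intro[where K="norm c"])
  fix r and x :: 'a
  show "c *\<^sub>C (r *\<^sub>R x) = r *\<^sub>R (c *\<^sub>C x)"
    by (metis mult.commute scaleC_of_real scaleC_scaleC)
qed (simp_all add: scaleC_add_right norm_scaleC mult.commute)

lemma scaleC_op_apply [simp]: "blinfun_apply (scaleC_op c A) x = c *\<^sub>C blinfun_apply A x"
proof -
  have "bounded_linear (\<lambda>x. c *\<^sub>C blinfun_apply A x)"
    by (rule bounded_linear_compose[OF bounded_linear_scaleC blinfun.bounded_linear_right])
  then show ?thesis
    by (simp add: scaleC_op_def bounded_linear_Blinfun_apply)
qed

lemma Re_cinner_le: "Re (cinner x y) \<le> norm x * norm (y::'a::complex_inner)"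
proof -
  have "(norm (x + y))\<^sup>2 \<le> (norm x + norm y)\<^sup>2"
    by (intro power_mono norm_triangle_ineq) simp
  then show ?thesis
    by (simp add: norm_add_square power2_sum)
qed

lemma abs_Re_cinner_le: "\<bar>Re (cinner x y)\<bar> \<le> norm x * norm (y::'a::complex_inner)"
proof -
  have "Re (cinner (- x) y) = - Re (cinner x y)"
    using cinner_scaleR_left[of "-1" x y] by simp
  then show ?thesis
    using Re_cinner_le[of x y] Re_cinner_le[of "-x" y] by simp
qed

lemma cinner_eqI:
  assumes "\<And>x. cinner x y = cinner x (z::'a::complex_inner)"
  shows "y = z"
proof -
  have "cinner (y - z) (y - z) = 0"
    by (simp add: cinner_diff_right assms)
  then show ?thesis
    by (simp add: cinner_self)
qed

lemma cinner_eqI_Re: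
  assumes "\<And>x. Re (f x) = Re (cinner x z)"
    and "\<And>c x. f (c *\<^sub>C x) = c * f x"
  shows "f x = cinner x (z::'a::complex_inner)"
proof (rule complex_eqI)
  have "Re (f (\<i> *\<^sub>C x)) = Re (cinner (\<i> *\<^sub>C x) z)"
    by (rule assms(1))
  then show "Im (f x) = Im (cinner x z)"
    by (simp add: assms(2) cinner_scaleC_left)
qed (rule assms(1))

lemma quadratic_nonneg_imp_zero:
  fixes a b :: real
  assumes "\<And>t. 0 \<le> t\<^sup>2 * a + 2 * t * b" and "a \<ge> 0"
  shows "b = 0"
proof -
  define t where "t = - b / (a + 1)"
  have t: "t * (a + 1) = - b"
    using assms(2) by (simp add: t_def)
  have "0 \<le> (a + 1)\<^sup>2 * (t\<^sup>2 * a + 2 * t * b)"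
    by (intro mult_nonneg_nonneg assms(1)) simp
  also have "\<dots> = (t * (a + 1))\<^sup>2 * a + 2 * (t * (a + 1)) * b * (a + 1)"
    by algebra
  also have "\<dots> = - (b\<^sup>2 * (a + 2))"
    unfolding t by algebra
  finally have "b\<^sup>2 * (a + 2) \<le> 0" by simp
  then show ?thesis
    using assms(2) by (simp add: mult_le_0_iff)
qed

lemma Riesz_real:
  fixes g :: "'a::chilbert_space \<Rightarrow> real"
  assumes g: "bounded_linear g"
  shows "\<exists>z. \<forall>x. g x = Re (cinner x z)"
proof -
  interpret g: bounded_linear g by (rule g)
  define p where "p x = (norm x)\<^sup>2 - 2 * g x" for x
  define m where "m = Inf (range p)"
  obtain K where K: "\<And>x. norm (g x) \<le> norm x * K"
    using g.bounded by blast
  have "- K\<^sup>2 \<le> p x" for x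
  proof -
    have "g x \<le> norm x * K"
      using K[of x] by simp
    moreover have "0 \<le> (norm x - K)\<^sup>2" by simp
    ultimately show ?thesis
      by (simp add: p_def power2_diff)
  qed
  then have bdd: "bdd_below (range p)"
    by (intro bdd_belowI[of _ "- K\<^sup>2"]) auto
  have m: "m \<le> p x" for x
    unfolding m_def by (rule cInf_lower[OF _ bdd]) simp
  have "\<exists>x. p x < m + inverse (real (Suc n))" for n
  proof -
    have "Inf (range p) < m + inverse (real (Suc n))"
      by (simp add: m_def)
    then show ?thesis
      by (subst (asm) cInf_less_iff[OF _ bdd]) auto
  qed
  then obtain s where s: "\<And>n. p (s n) < m + inverse (real (Suc n))"
    by metis
  have par: "(norm (x - y))\<^sup>2 = 2 * p x + 2 * p y - 4 * p ((1/2) *\<^sub>R (x + y))" for x y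
  proof -
    have "p ((1/2) *\<^sub>R (x + y)) = (norm (x + y))\<^sup>2 / 4 - (g x + g y)"
      unfolding p_def g.scaleR g.add norm_scaleR
      by (simp add: power_mult_distrib power2_eq_square algebra_simps del: scaleR_add_right)
    moreover have "(norm (x - y))\<^sup>2 = (norm x)\<^sup>2 - 2 * Re (cinner x y) + (norm y)\<^sup>2"
      using norm_add_square[of x "-y"] cinner_scaleR_right[of x "-1" y] by simp
    ultimately show ?thesis
      using norm_add_square[of x y] p_def[of x] p_def[of y] by linarith
  qed
  have "Cauchy s"
  proof (rule metric_CauchyI)
    fix \<epsilon> :: real assume "\<epsilon> > 0"
    then obtain N where N: "inverse (real (Suc N)) < \<epsilon>\<^sup>2 / 4"
      using reals_Archimedean[of "\<epsilon>\<^sup>2 / 4"] by auto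
    have "dist (s i) (s j) < \<epsilon>" if "i \<ge> N" "j \<ge> N" for i j
    proof -
      have "inverse (real (Suc i)) \<le> inverse (real (Suc N))"
        "inverse (real (Suc j)) \<le> inverse (real (Suc N))"
        using that by (auto intro!: le_imp_inverse_le)
      then have "p (s i) < m + \<epsilon>\<^sup>2 / 4" "p (s j) < m + \<epsilon>\<^sup>2 / 4"
        using s[of i] s[of j] N by linarith+
      then have "(norm (s i - s j))\<^sup>2 < \<epsilon>\<^sup>2"
        using par[of "s i" "s j"] m[of "(1/2) *\<^sub>R (s i + s j)"] by linarith
      then show ?thesis
        using \<open>\<epsilon> > 0\<close> by (simp add: dist_norm power_less_imp_less_base)
    qed
    then show "\<exists>M. \<forall>i\<ge>M. \<forall>j\<ge>M. dist (s i) (s j) < \<epsilon>" by blast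
  qed
  then obtain z where z: "s \<longlonglongrightarrow> z"
    using Cauchy_convergent convergent_def by blast
  have "(\<lambda>n. p (s n)) \<longlonglongrightarrow> p z"
    unfolding p_def by (intro tendsto_intros g.tendsto z)
  moreover have "(\<lambda>n. m + inverse (real (Suc n))) \<longlonglongrightarrow> m + 0"
    by (intro tendsto_intros LIMSEQ_inverse_real_of_nat)
  ultimately have "p z \<le> m"
    using s by (intro LIMSEQ_le) (auto intro: less_imp_le)
  then have min: "p z \<le> p x" for x
    using m[of x] by simp
  have "g x = Re (cinner x z)" for x
  proof -
    have "0 \<le> t\<^sup>2 * (norm x)\<^sup>2 + 2 * t * (Re (cinner x z) - g x)" for t
      using min[of "t *\<^sub>R x + z"] norm_add_square[of "t *\<^sub>R x" z]
      by (simp add: p_def g.add g.scaleR cinner_scaleR_left power_mult_distrib algebra_simps)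
    then have "Re (cinner x z) - g x = 0"
      by (rule quadratic_nonneg_imp_zero) simp
    then show ?thesis by simp
  qed
  then show ?thesis by blast
qed

lemma adjoint_exists:
  fixes A :: "'a::chilbert_space \<Rightarrow>\<^sub>L 'a"
  assumes "A \<in> BH"
  shows "\<exists>B\<in>BH. \<forall>x y. cinner (blinfun_apply A x) y = cinner x (blinfun_apply B y)"
proof -
  have "\<exists>z. \<forall>x. cinner (blinfun_apply A x) y = cinner x z" for y
  proof -
    have "bounded_linear (\<lambda>x. Re (cinner (blinfun_apply A x) y))"
    proof (rule bounded_linear_intro[where K="norm A * norm y"])
      fix x
      have "norm (Re (cinner (blinfun_apply A x) y)) \<le> norm (blinfun_apply A x) * norm y"
        using abs_Re_cinner_le by simp
      also have "\<dots> \<le> (norm A * norm x) * norm y"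
        by (intro mult_right_mono norm_blinfun) simp
      finally show "norm (Re (cinner (blinfun_apply A x) y)) \<le> norm x * (norm A * norm y)"
        by (simp add: mult_ac)
    qed (simp_all add: blinfun.add_right blinfun.scaleR_right cinner_add_left cinner_scaleR_left)
    from Riesz_real[OF this] obtain z
      where z: "\<And>x. Re (cinner (blinfun_apply A x) y) = Re (cinner x z)" by blast
    have "cinner (blinfun_apply A x) y = cinner x z" for x
      by (rule cinner_eqI_Re[of "\<lambda>x. cinner (blinfun_apply A x) y"])
        (use assms in \<open>auto simp: z BH_def cinner_scaleC_left\<close>)
    then show ?thesis by blast
  qed
  then obtain f where f: "\<And>x y. cinner (blinfun_apply A x) y = cinner x (f y)" by metis
  have fC: "f (c *\<^sub>C y) = c *\<^sub>C f y" for c y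
    by (rule cinner_eqI) (simp add: f[symmetric] cinner_scaleC_right)
  have bl: "bounded_linear f"
  proof (rule bounded_linear_intro[where K="norm A"])
    show "f (x + y) = f x + f y" for x y
      by (rule cinner_eqI) (simp add: f[symmetric] cinner_add_right)
    show "f (r *\<^sub>R x) = r *\<^sub>R f x" for r x
      using fC[of "of_real r"] by (simp add: scaleC_of_real)
    show "norm (f x) \<le> norm x * norm A" for x
    proof (cases "f x = 0")
      case False
      have "(norm (f x))\<^sup>2 = Re (cinner (blinfun_apply A (f x)) x)"
        by (simp add: f cinner_self)
      also have "\<dots> \<le> norm (blinfun_apply A (f x)) * norm x"
        by (rule Re_cinner_le)
      also have "\<dots> \<le> (norm A * norm (f x)) * norm x"
        by (intro mult_right_mono norm_blinfun) simp
      finally have "norm (f x) * norm (f x) \<le> norm (f x) * (norm x * norm A)"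
        by (simp add: power2_eq_square mult_ac)
      then show ?thesis
        using False by simp
    qed simp
  qed
  show ?thesis
    by (rule bexI[of _ "Blinfun f"])
      (auto simp: bounded_linear_Blinfun_apply[OF bl] f fC BH_def)
qed

lemma adjoint_unique:
  assumes "\<And>x y. cinner (blinfun_apply A x) y = cinner x (blinfun_apply B y)"
    and "\<And>x y. cinner (blinfun_apply A x) y = cinner x (blinfun_apply C y)"
  shows "B = C"
  by (rule blinfun_eqI, rule cinner_eqI) (metis assms)

lemma
  assumes "A \<in> BH"
  shows adj_in_BH: "adj A \<in> BH"
    and cinner_adj: "cinner (blinfun_apply A x) y = cinner x (blinfun_apply (adj A) y)"
proof -
  have "\<exists>!B. B \<in> BH \<and> (\<forall>x y. cinner (blinfun_apply A x) y = cinner x (blinfun_apply B y))"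
    using adjoint_exists[OF assms] adjoint_unique by (metis (no_types))
  from theI'[OF this]
  show "adj A \<in> BH" "cinner (blinfun_apply A x) y = cinner x (blinfun_apply (adj A) y)"
    unfolding adj_def by blast+
qed

end

(*
  Put f = u e u and c = e u e. Since e - e f e = e - c^2 is invertible in e B(H) e, the hermitian
  operator e - f has a spectral gap at 0, and its spectral projection q0 for the positive half-line
  lies in C(e,f). As u (e - f) u = -(e - f), the projection u q0 u belongs to the negative
  half-line, so q0 u q0 = 0. In the generic 2x2 picture, where e projects onto (cos t, sin t) and
  u = diag(1,-1), q0 is the projection onto the diagonal, at distance |sin(t - pi/4)| from e;
  accordingly |e - q0|^2 <= (1 - sqrt(1 - |c|^2)) / 2.

  Conversely, let q be any projection with q u q = 0 and d = |e - q|, d^2 <= 1/2. A vector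
  v = e v splits as y + z with y = q v and |z| <= d |v|, and <u y, y> = 0 forces
  |<u v, v>| <= 2 d sqrt(1 - d^2) |v|^2. Hence |c| <= 2 d sqrt(1 - d^2), which says that
  d^2 >= (1 - sqrt(1 - |c|^2)) / 2.
*)

theory Submission
  imports Defs
begin

text \<open>Passes completeness on to the operator space, where Banach's fixed point theorem is
  applied.\<close>

instance chilbert_space \<subseteq> banach ..

section \<open>Inner products and self-adjoint operators\<close>

lemma cinner_diff_left: "cinner (x - y) z = cinner x z - cinner y (z::'a::complex_inner)"
  by (metis cinner_add_left add_diff_cancel diff_add_cancel)

lemma cinner_zero_left [simp]: "cinner 0 (x::'a::complex_inner) = 0"
  using cinner_diff_left[of 0 0 x] by simp

lemma Re_cinner_commute: "Re (cinner x y) = Re (cinner y (x::'a::complex_inner))"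
  by (metis cinner_commute cnj.simps(1))

lemma Re_cinner_self: "Re (cinner x x) = (norm (x::'a::complex_inner))\<^sup>2"
  by (simp add: cinner_self)

lemma norm_diff_square:
  "(norm (x - y))\<^sup>2 = (norm x)\<^sup>2 - 2 * Re (cinner x y) + (norm (y::'a::complex_inner))\<^sup>2"
  using norm_add_square[of x "-y"] cinner_scaleR_right[of x "-1" y] by simp

lemma bounded_linear_cinner_left: "bounded_linear (\<lambda>x. cinner x (y::'a::complex_inner))"
\<comment> \<open>Real and imaginary part are each at most |x| |y|, the latter seen by replacing
  \<open>x\<close> with i x. The factor 2 adds the two bounds; only continuity is wanted.\<close>
proof (rule bounded_linear_intro[where K="2 * norm y"])
  fix x
  have "Re (cinner (\<i> *\<^sub>C x) y) = - Im (cinner x y)"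
    by (simp add: cinner_scaleC_left)
  then have "\<bar>Im (cinner x y)\<bar> \<le> norm x * norm y"
    using abs_Re_cinner_le[of "\<i> *\<^sub>C x" y] by (simp add: norm_scaleC)
  then show "norm (cinner x y) \<le> norm x * (2 * norm y)"
    using cmod_le[of "cinner x y"] abs_Re_cinner_le[of x y] by simp
qed (simp_all add: cinner_add_left cinner_scaleR_left scaleR_conv_of_real)

lemma continuous_on_cinner_left [continuous_intros]:
  "continuous_on A f \<Longrightarrow> continuous_on A (\<lambda>x. cinner (f x) (y::'a::complex_inner))"
  by (rule bounded_linear.continuous_on[OF bounded_linear_cinner_left])

lemma continuous_on_cinner_right [continuous_intros]:
  "continuous_on A f \<Longrightarrow> continuous_on A (\<lambda>x. cinner (y::'a::complex_inner) (f x))"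
  by (subst cinner_commute) (intro continuous_intros)

lemma continuous_on_blinfun_compose [continuous_intros]:
  "continuous_on A f \<Longrightarrow> continuous_on A g \<Longrightarrow> continuous_on A (\<lambda>x. f x o\<^sub>L g x)"
  by (rule bounded_bilinear.continuous_on[OF bounded_bilinear_blinfun_compose])

text \<open>Stated through inner products, the condition is visibly closed and serves directly for
  rewriting, without the definite description in \<open>adj\<close>.\<close>

definition selfadjoint :: "('a::chilbert_space \<Rightarrow>\<^sub>L 'a) \<Rightarrow> bool"
  where "selfadjoint A \<longleftrightarrow> A \<in> BH \<and> (\<forall>x y. cinner (A x) y = cinner x (A y))"

lemma adj_eqI:
  assumes "A \<in> BH" "\<And>x y. cinner (blinfun_apply A x) y = cinner x (blinfun_apply B y)"
  shows "adj A = B"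
  using adjoint_unique[OF cinner_adj[OF assms(1)] assms(2)] .

lemma selfadjoint_iff_adj: "selfadjoint A \<longleftrightarrow> A \<in> BH \<and> adj A = A"
  unfolding selfadjoint_def by (metis adj_eqI cinner_adj)

lemma closed_BH: "closed (BH :: ('a::chilbert_space \<Rightarrow>\<^sub>L 'a) set)"
  unfolding BH_def
  by (intro closed_Collect_all closed_Collect_eq continuous_intros
      bounded_linear.continuous_on[OF bounded_linear_scaleC])

lemma closed_selfadjoint: "closed {A :: 'a::chilbert_space \<Rightarrow>\<^sub>L 'a. selfadjoint A}"
  unfolding selfadjoint_def
  by (intro closed_Collect_conj closed_Collect_all closed_Collect_eq continuous_intros)
    (simp add: closed_BH)

lemma selfadjoint_add: "selfadjoint A \<Longrightarrow> selfadjoint B \<Longrightarrow> selfadjoint (A + B)"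
  by (auto simp: selfadjoint_def BH_def blinfun.bilinear_simps scaleC_add_right
      cinner_add_left cinner_add_right)

lemma selfadjoint_scaleR: "selfadjoint A \<Longrightarrow> selfadjoint (r *\<^sub>R A)"
  by (auto simp: selfadjoint_def BH_def blinfun.bilinear_simps scaleC_of_real[symmetric]
      scaleC_scaleC cinner_scaleC_left cinner_scaleC_right mult.commute)

lemma selfadjoint_minus: "selfadjoint A \<Longrightarrow> selfadjoint B \<Longrightarrow> selfadjoint (A - B)"
  using selfadjoint_add[of A "-1 *\<^sub>R B"] selfadjoint_scaleR[of B "-1"] by simp

lemma selfadjoint_compose:
  assumes "selfadjoint A" "selfadjoint B" "A o\<^sub>L B = B o\<^sub>L A"
  shows "selfadjoint (A o\<^sub>L B)"
proof -
  have "A (B x) = B (A x)" for x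
    using assms(3) by (metis blinfun_apply_blinfun_compose)
  then show ?thesis
    using assms(1,2) by (simp add: selfadjoint_def BH_def)
qed

lemma selfadjoint_conjugate: "selfadjoint A \<Longrightarrow> selfadjoint B \<Longrightarrow> selfadjoint (B o\<^sub>L A o\<^sub>L B)"
  by (auto simp: selfadjoint_def BH_def)

text \<open>Polarisation with \<open>y\<close> a positive multiple of \<open>A x\<close> of the same
  norm as \<open>x\<close>; the parallelogram law turns the bound on the quadratic form into one on
  |A x|.\<close>

lemma norm_le_numerical_radius:
  fixes A :: "'a::chilbert_space \<Rightarrow>\<^sub>L 'a"
  assumes A: "selfadjoint A"
    and k: "\<And>x. \<bar>Re (cinner (A x) x)\<bar> \<le> k * (norm x)\<^sup>2"
    and "0 \<le> k"
  shows "norm A \<le> k"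
proof (rule norm_blinfun_bound[OF \<open>0 \<le> k\<close>])
  fix x
  show "norm (A x) \<le> k * norm x"
  proof (cases "A x = 0 \<or> x = 0")
    case True
    then show ?thesis using \<open>0 \<le> k\<close> by auto
  next
    case False
    define y where "y = (norm x / norm (A x)) *\<^sub>R A x"
    have ny: "norm y = norm x"
      using False by (simp add: y_def)
    have sym: "Re (cinner (A y) x) = Re (cinner (A x) y)"
      using A by (metis selfadjoint_def Re_cinner_commute)
    have "Re (cinner (A (x + y)) (x + y)) - Re (cinner (A (x - y)) (x - y)) = 4 * Re (cinner (A x) y)"
      by (simp add: blinfun.bilinear_simps cinner_add_left cinner_add_right cinner_diff_left
          cinner_diff_right sym)
    then have "4 * Re (cinner (A x) y) \<le> k * (norm (x + y))\<^sup>2 + k * (norm (x - y))\<^sup>2"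
      using k[of "x + y"] k[of "x - y"] by linarith
    also have "\<dots> = 4 * (k * (norm x)\<^sup>2)"
      by (simp add: norm_add_square norm_diff_square ny algebra_simps)
    finally have "Re (cinner (A x) y) \<le> k * (norm x)\<^sup>2" by simp
    moreover have "Re (cinner (A x) y) = norm x * norm (A x)"
      using False by (simp add: y_def cinner_scaleR_right Re_cinner_self cinner_self power2_eq_square)
    ultimately have "norm x * norm (A x) \<le> norm x * (k * norm x)"
      by (simp add: power2_eq_square mult_ac)
    then show ?thesis
      using False by simp
  qed
qed

section \<open>The lower bound for the distance\<close>

text \<open>Split z = t u y + w with \<open>w\<close> orthogonal to \<open>u y\<close> in the real
  sense. Then \<open>w\<close> is orthogonal to \<open>y\<close> as well, the form has the value 2 t
  |y|^2 + Re <u w, w>, and |w|^2 = |z|^2 - k^2 for k = |t| |y|. The bound 2 k |y| + |z|^2 - k^2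
  increases for k <= |y|, so k = |z| is the worst case.\<close>

lemma numerical_value_le:
  fixes u :: "'a::chilbert_space \<Rightarrow>\<^sub>L 'a"
  assumes u: "selfadjoint u" "\<And>x. u (u x) = x"
    and yz: "Re (cinner y z) = 0" "Re (cinner (u y) y) = 0" "norm z \<le> norm y"
  shows "\<bar>Re (cinner (u (y + z)) (y + z))\<bar> \<le> 2 * norm z * norm y"
proof (cases "y = 0")
  case True
  then show ?thesis using yz(3) by (simp add: blinfun.bilinear_simps)
next
  case False
  have us: "cinner (u a) b = cinner a (u b)" for a b
    using u(1) by (simp add: selfadjoint_def)
  have nu: "norm (u a) = norm a" for a
    by (rule power2_eq_imp_eq) (simp_all add: Re_cinner_self[symmetric] us u(2))
  define t where "t = Re (cinner z (u y)) / (norm y)\<^sup>2"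
  define w where "w = z - t *\<^sub>R u y"
  have z: "z = t *\<^sub>R u y + w"
    by (simp add: w_def)
  have t: "Re (cinner z (u y)) = t * (norm y)\<^sup>2"
    using False by (simp add: t_def)
  have wuy: "Re (cinner w (u y)) = 0"
    by (simp add: w_def cinner_diff_left cinner_scaleR_left t Re_cinner_self nu)
  have uyy: "Re (cinner y (u y)) = 0"
    using yz(2) by (simp add: us)
  have wy: "Re (cinner y w) = 0"
    by (simp add: w_def cinner_diff_right cinner_scaleR_right yz(1) uyy)
  have nz: "(norm z)\<^sup>2 = t\<^sup>2 * (norm y)\<^sup>2 + (norm w)\<^sup>2"
    unfolding z norm_add_square using Re_cinner_commute[of "u y" w]
    by (simp add: cinner_scaleR_left wuy nu power_mult_distrib)
  have "Re (cinner (u w) w) \<le> (norm w)\<^sup>2" "- Re (cinner (u w) w) \<le> (norm w)\<^sup>2"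
    using abs_Re_cinner_le[of "u w" w] by (simp_all add: nu power2_eq_square)
  then have ww: "\<bar>Re (cinner (u w) w)\<bar> \<le> (norm w)\<^sup>2" by linarith
  have wuy': "Re (cinner (u y) w) = 0"
    using wuy Re_cinner_commute[of "u y" w] by simp
  have uz: "u z = t *\<^sub>R y + u w"
    by (subst z) (simp add: blinfun.bilinear_simps u(2))
  have uwuy: "Re (cinner (u w) (u y)) = 0"
    using wy Re_cinner_commute[of w y] by (simp add: us u(2))
  have uzz: "Re (cinner (u z) z) = Re (cinner (u w) w)"
    unfolding uz by (subst z)
      (simp add: cinner_add_left cinner_add_right cinner_scaleR_left cinner_scaleR_right uyy wy uwuy)
  have uyz: "Re (cinner (u y) z) = t * (norm y)\<^sup>2" "Re (cinner (u z) y) = t * (norm y)\<^sup>2"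
    using t Re_cinner_commute[of "u y" z] by (simp_all add: us)
  have val: "Re (cinner (u (y + z)) (y + z)) = 2 * t * (norm y)\<^sup>2 + Re (cinner (u w) w)"
    by (simp add: blinfun.bilinear_simps cinner_add_left cinner_add_right uyz uzz yz(2))
  define k where "k = \<bar>t\<bar> * norm y"
  have k2: "k\<^sup>2 + (norm w)\<^sup>2 = (norm z)\<^sup>2"
    by (simp add: nz k_def power_mult_distrib)
  then have "k\<^sup>2 \<le> (norm z)\<^sup>2" by (simp add: algebra_simps flip: k2)
  then have kz: "k \<le> norm z" by (rule power2_le_imp_le) simp
  \<comment> \<open>The product is 2 |z| |y| - (2 k |y| + |z|^2 - k^2).\<close>
  have "0 \<le> (norm z - k) * (2 * norm y - norm z - k)"
    using kz yz(3) by (intro mult_nonneg_nonneg) linarith+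
  moreover have "\<bar>Re (cinner (u (y + z)) (y + z))\<bar> \<le> 2 * k * norm y + (norm w)\<^sup>2"
  proof -
    have "\<bar>2 * t * (norm y)\<^sup>2\<bar> = 2 * k * norm y"
      by (simp add: k_def abs_mult power2_eq_square)
    then show ?thesis
      unfolding val using ww by linarith
  qed
  ultimately show ?thesis
    using k2 by (simp add: algebra_simps power2_eq_square)
qed

lemma norm_compression_le:
  fixes e q u :: "'a::chilbert_space \<Rightarrow>\<^sub>L 'a"
  assumes e: "selfadjoint e" "\<And>x. e (e x) = e x" "norm e \<le> 1"
    and u: "selfadjoint u" "\<And>x. u (u x) = x"
    and q: "selfadjoint q" "\<And>x. q (q x) = q x" "\<And>x. q (u (q x)) = 0"
    and d: "2 * (norm (e - q))\<^sup>2 \<le> 1"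
  shows "(norm (e o\<^sub>L u o\<^sub>L e))\<^sup>2 \<le> 1 - (1 - 2 * (norm (e - q))\<^sup>2)\<^sup>2"
proof -
  define d where "d = norm (e - q)"
  \<comment> \<open>This is 2 d sqrt(1 - d^2), the value of 2 |z| |y| when |v| = 1 and |z| =
    d.\<close>
  define k where "k = sqrt (1 - (1 - 2 * d\<^sup>2)\<^sup>2)"
  have d01: "0 \<le> d" "2 * d\<^sup>2 \<le> 1"
    using d by (simp_all add: d_def)
  then have k1: "0 \<le> 1 - (1 - 2 * d\<^sup>2)\<^sup>2"
    using abs_square_le_1[of "1 - 2 * d\<^sup>2"] by simp
  have es: "cinner (e a) b = cinner a (e b)" and qs: "cinner (q a) b = cinner a (q b)" for a b
    using e(1) q(1) by (simp_all add: selfadjoint_def)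
  have "norm (e o\<^sub>L u o\<^sub>L e) \<le> k"
  proof (rule norm_le_numerical_radius)
    show "selfadjoint (e o\<^sub>L u o\<^sub>L e)"
      using u(1) e(1) by (rule selfadjoint_conjugate)
    show "0 \<le> k" using k1 by (simp add: k_def)
    fix x
    define v where "v = e x"
    define y where "y = q v"
    define z where "z = v - q v"
    have ev: "e v = v" by (simp add: v_def e(2))
    have "cinner y z = 0"
      by (simp add: y_def z_def cinner_diff_right qs blinfun.bilinear_simps q(2))
    then have yz: "Re (cinner y z) = 0" by simp
    have "cinner (u y) y = cinner (q (u (q v))) v"
      by (simp add: y_def qs)
    then have uy: "Re (cinner (u y) y) = 0" by (simp add: q(3))
    have v: "v = y + z" by (simp add: y_def z_def)
    have nv: "(norm v)\<^sup>2 = (norm y)\<^sup>2 + (norm z)\<^sup>2"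
      unfolding v norm_add_square by (simp add: yz)
    have "norm z = norm ((e - q) v)"
      by (simp add: z_def blinfun.bilinear_simps ev)
    also have "\<dots> \<le> d * norm v"
      unfolding d_def by (rule norm_blinfun)
    finally have zd: "(norm z)\<^sup>2 \<le> d\<^sup>2 * (norm v)\<^sup>2"
      by (metis norm_ge_zero power_mono power_mult_distrib)
    have d2: "d\<^sup>2 * (norm v)\<^sup>2 \<le> (norm v)\<^sup>2 / 2"
      using mult_right_mono[OF d01(2), of "(norm v)\<^sup>2"] by simp
    have "(norm z)\<^sup>2 \<le> (norm y)\<^sup>2"
      using zd d2 nv by linarith
    then have zy: "norm z \<le> norm y" by (rule power2_le_imp_le) simp
    have "2 * norm z * norm y \<le> k * (norm v)\<^sup>2"
    proof (rule power2_le_imp_le)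
      \<comment> \<open>With s = |z|^2 and a = d^2 |v|^2 the product is a (|v|^2 - a) - s (|v|^2 -
        s): the function s (|v|^2 - s) increases up to |v|^2 / 2, and s <= a <= |v|^2 / 2.\<close>
      have "0 \<le> (d\<^sup>2 * (norm v)\<^sup>2 - (norm z)\<^sup>2) * ((norm v)\<^sup>2 - d\<^sup>2 * (norm v)\<^sup>2 - (norm z)\<^sup>2)"
        using zd d2 by (intro mult_nonneg_nonneg) linarith+
      then have "4 * ((norm z)\<^sup>2 * ((norm v)\<^sup>2 - (norm z)\<^sup>2)) \<le> 4 * (d\<^sup>2 * (norm v)\<^sup>2 * ((norm v)\<^sup>2 - d\<^sup>2 * (norm v)\<^sup>2))"
        by (simp add: algebra_simps power2_eq_square)
      also have "\<dots> = (1 - (1 - 2 * d\<^sup>2)\<^sup>2) * ((norm v)\<^sup>2)\<^sup>2"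
        by algebra
      finally show "(2 * norm z * norm y)\<^sup>2 \<le> (k * (norm v)\<^sup>2)\<^sup>2"
        using k1 nv by (simp add: k_def power_mult_distrib)
    qed (use k1 in \<open>simp add: k_def\<close>)
    moreover have "k * (norm v)\<^sup>2 \<le> k * (norm x)\<^sup>2"
    proof (intro mult_left_mono power_mono)
      have "norm v \<le> norm e * norm x" unfolding v_def by (rule norm_blinfun)
      also have "\<dots> \<le> 1 * norm x" using e(3) by (intro mult_right_mono) auto
      finally show "norm v \<le> norm x" by simp
    qed (use k1 in \<open>simp_all add: k_def\<close>)
    moreover have "cinner ((e o\<^sub>L u o\<^sub>L e) x) x = cinner (u v) v"
      by (simp add: v_def es)
    ultimately show "\<bar>Re (cinner ((e o\<^sub>L u o\<^sub>L e) x) x)\<bar> \<le> k * (norm x)\<^sup>2"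
      using numerical_value_le[OF u yz uy zy] v by simp
  qed
  then have "(norm (e o\<^sub>L u o\<^sub>L e))\<^sup>2 \<le> k\<^sup>2"
    by (intro power_mono) auto
  then show ?thesis
    using k1 by (simp add: k_def d_def)
qed

section \<open>Generated algebras\<close>

lemma C_star_generated_superset: "X \<subseteq> C_star_generated X"
  unfolding C_star_generated_def by (rule hull_subset)

lemma closed_C_star_generated: "closed (C_star_generated X)"
  unfolding C_star_generated_def hull_def C_star_subalgebra_def by (intro closed_Inter) auto

lemma C_star_generated_add:
  "A \<in> C_star_generated X \<Longrightarrow> B \<in> C_star_generated X \<Longrightarrow> A + B \<in> C_star_generated X"
  unfolding C_star_generated_def hull_def C_star_subalgebra_def star_subalgebra_def by blast

lemma C_star_generated_compose:
  "A \<in> C_star_generated X \<Longrightarrow> B \<in> C_star_generated X \<Longrightarrow> A o\<^sub>L B \<in> C_star_generated X"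
  unfolding C_star_generated_def hull_def C_star_subalgebra_def star_subalgebra_def by blast

lemma C_star_generated_scaleR:
  assumes "A \<in> C_star_generated X"
  shows "r *\<^sub>R A \<in> C_star_generated X"
proof -
  have "scaleC_op (of_real r) A = r *\<^sub>R A"
    by (rule blinfun_eqI) (simp add: scaleC_of_real blinfun.bilinear_simps)
  moreover have "scaleC_op (of_real r) A \<in> C_star_generated X"
    using assms
    unfolding C_star_generated_def hull_def C_star_subalgebra_def star_subalgebra_def by blast
  ultimately show ?thesis by simp
qed

lemma C_star_generated_diff:
  "A \<in> C_star_generated X \<Longrightarrow> B \<in> C_star_generated X \<Longrightarrow> A - B \<in> C_star_generated X"
  using C_star_generated_add[of A X "-1 *\<^sub>R B"] C_star_generated_scaleR[of B X "-1"] by simp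

text \<open>The maps A |-> <A x, y> are norm continuous, so a weakly closed set is the trace on
  \<open>BH\<close> of a norm closed one, and \<open>BH\<close> itself is norm closed.\<close>

lemma W_star_subalgebra_imp_C_star_subalgebra:
  fixes S :: "('a::chilbert_space \<Rightarrow>\<^sub>L 'a) set"
  assumes "W_star_subalgebra S"
  shows "C_star_subalgebra S"
proof -
  let ?f = "\<lambda>(A :: 'a \<Rightarrow>\<^sub>L 'a) (x, y). cinner (A x) y"
  have cont: "continuous_on UNIV ?f"
    by (rule continuous_on_coordinatewise_then_product) (auto intro!: continuous_intros)
  have S: "S \<subseteq> BH" "openin weak_operator_topology (topspace weak_operator_topology - S)"
    using assms by (auto simp: W_star_subalgebra_def star_subalgebra_def closedin_def)
  have top: "topspace weak_operator_topology = (BH :: ('a \<Rightarrow>\<^sub>L 'a) set)"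
    by (simp add: weak_operator_topology_def topspace_pullback_topology)
  obtain U where U: "open U" "BH - S = ?f -` U \<inter> BH"
    using S(2) unfolding top
    by (auto simp: weak_operator_topology_def openin_pullback_topology)
  then have "S = BH - ?f -` U"
    using S(1) by blast
  moreover have "open (?f -` U)"
    using U(1) cont by (rule open_vimage)
  ultimately show ?thesis
    using assms closed_BH by (auto simp: C_star_subalgebra_def W_star_subalgebra_def intro: closed_Diff)
qed

text \<open>Puts the nearest projection, found in the smaller algebra, among the competitors in the
  larger one.\<close>

lemma C_star_generated_subset_W_star_generated:
  assumes "adj u = u"
  shows "C_star_generated {e, u o\<^sub>L e o\<^sub>L adj u} \<subseteq> W_star_generated {e, u}"
  unfolding W_star_generated_def hull_def
proof (rule Inter_greatest, clarify)
  fix T A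
  assume T: "W_star_subalgebra T" "{e, u} \<subseteq> T" and A: "A \<in> C_star_generated {e, u o\<^sub>L e o\<^sub>L adj u}"
  have "{e, u o\<^sub>L e o\<^sub>L adj u} \<subseteq> T"
    using T by (auto simp: assms W_star_subalgebra_def star_subalgebra_def)
  then have "C_star_generated {e, u o\<^sub>L e o\<^sub>L adj u} \<subseteq> T"
    unfolding C_star_generated_def
    by (rule hull_minimal) (rule W_star_subalgebra_imp_C_star_subalgebra[OF T(1)])
  then show "A \<in> T"
    using A by (rule subsetD)
qed

section \<open>The nearest projection\<close>

text \<open>
  The functional calculus of \<open>c = e u e\<close> in the corner \<open>e B(H) e\<close> is replaced by fixed points of
  contractions on the following closed set.  The last condition says that \<open>Y\<close> commutes with \<open>c\<close>,
  in a form suited to rewriting.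
\<close>

definition corner :: "('a::chilbert_space \<Rightarrow>\<^sub>L 'a) \<Rightarrow> ('a \<Rightarrow>\<^sub>L 'a) \<Rightarrow> ('a \<Rightarrow>\<^sub>L 'a) set \<Rightarrow> ('a \<Rightarrow>\<^sub>L 'a) set"
  where "corner e u C = {Y. selfadjoint Y \<and> Y \<in> C \<and> u o\<^sub>L Y o\<^sub>L u \<in> C \<and> e o\<^sub>L Y = Y \<and> Y o\<^sub>L e = Y \<and>
    Y o\<^sub>L u o\<^sub>L e = e o\<^sub>L u o\<^sub>L Y}"

lemma closed_corner:
  assumes "closed C"
  shows "closed (corner e u C)"
proof -
  have "closed {Y. u o\<^sub>L Y o\<^sub>L u \<in> C}"
    using closed_vimage[OF assms, of "\<lambda>Y. u o\<^sub>L Y o\<^sub>L u"]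
    by (simp add: vimage_def continuous_intros)
  then show ?thesis
    unfolding corner_def using assms
    by (intro closed_Collect_conj closed_selfadjoint closed_Collect_eq continuous_intros) simp_all
qed

lemma blinfun_compose_assoc: "(A o\<^sub>L B) o\<^sub>L D = A o\<^sub>L (B o\<^sub>L D)"
  by (rule blinfun_eqI) simp

lemmas compose_simps =
  bounded_bilinear.add_left[OF bounded_bilinear_blinfun_compose]
  bounded_bilinear.add_right[OF bounded_bilinear_blinfun_compose]
  bounded_bilinear.diff_left[OF bounded_bilinear_blinfun_compose]
  bounded_bilinear.diff_right[OF bounded_bilinear_blinfun_compose]
  bounded_bilinear.scaleR_left[OF bounded_bilinear_blinfun_compose]
  bounded_bilinear.scaleR_right[OF bounded_bilinear_blinfun_compose]

locale acute_projection =
  fixes e u :: "'a::chilbert_space \<Rightarrow>\<^sub>L 'a"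
  assumes projection: "orthogonal_projection e"
    and involution: "hermitian_involution u"
    and acute: "norm (e o\<^sub>L u o\<^sub>L e) < 1"
begin

abbreviation "\<C> \<equiv> C_star_generated {e, u o\<^sub>L e o\<^sub>L adj u}"
abbreviation "\<K> \<equiv> corner e u \<C>"

text \<open>Twice the squared distance to be found, and the smaller root of t^2 - 2 t + |c|^2 for c
  = e u e. The ball of radius \<open>r\<close> is therefore invariant under Y |-> (c^2 + Y^2) / 2,
  and \<open>r < 1\<close> serves as contraction constant.\<close>

definition r :: real
  where "r = 1 - sqrt (1 - (norm (e o\<^sub>L u o\<^sub>L e))\<^sup>2)"

lemma self: "selfadjoint e" "selfadjoint u" and adj_u: "adj u = u"
  using projection involution
  by (auto simp: orthogonal_projection_def hermitian_involution_def selfadjoint_iff_adj)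

lemma ee [simp]: "e (e x) = e x"
  using projection by (metis orthogonal_projection_def blinfun_apply_blinfun_compose)

lemma uu [simp]: "u (u x) = x"
  using involution
  by (metis hermitian_involution_def blinfun_apply_blinfun_compose blinfun_apply_id_blinfun)

lemma cinner_e: "cinner (e x) y = cinner x (e y)" and cinner_u: "cinner (u x) y = cinner x (u y)"
  using self by (simp_all add: selfadjoint_def)

lemma r_bounds: "0 \<le> r" "r < 1"
  and r_eq: "(norm (e o\<^sub>L u o\<^sub>L e))\<^sup>2 + r\<^sup>2 = 2 * r"
proof -
  define s where "s = norm (e o\<^sub>L u o\<^sub>L e)"
  have "0 \<le> s" "s < 1" using acute by (simp_all add: s_def)
  then have s: "s\<^sup>2 < 1" by (simp add: power_less_one_iff)
  then show "0 \<le> r" "r < 1"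
    by (simp_all add: r_def flip: s_def)
  show "(norm (e o\<^sub>L u o\<^sub>L e))\<^sup>2 + r\<^sup>2 = 2 * r"
    using s by (simp add: r_def power2_diff flip: s_def)
qed

section \<open>Closure properties of the corner\<close>

lemma e_in_corner: "e \<in> \<K>"
  using C_star_generated_superset[of "{e, u o\<^sub>L e o\<^sub>L adj u}"] self(1)
  by (auto simp: corner_def adj_u intro: blinfun_eqI)

lemma corner_add: "A \<in> \<K> \<Longrightarrow> B \<in> \<K> \<Longrightarrow> A + B \<in> \<K>"
  by (auto simp: corner_def compose_simps selfadjoint_add C_star_generated_add)

lemma corner_scaleR: "A \<in> \<K> \<Longrightarrow> t *\<^sub>R A \<in> \<K>"
  by (auto simp: corner_def compose_simps selfadjoint_scaleR C_star_generated_scaleR)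

text \<open>Oriented as rewrite rules that move an element of the corner to the right across
  \<open>u\<close>; the last rule is the third one at \<open>A x\<close>.\<close>

lemma corner_applyD:
  assumes "A \<in> \<K>"
  shows "e (A x) = A x" "A (e x) = A x" "A (u (e x)) = e (u (A x))" "A (u (A x)) = e (u (A (A x)))"
proof -
  show *: "e (A x) = A x" "A (e x) = A x" "A (u (e x)) = e (u (A x))" for x
    using assms unfolding corner_def mem_Collect_eq by (metis blinfun_apply_blinfun_compose)+
  show "A (u (A x)) = e (u (A (A x)))"
    by (metis *(1,3))
qed

text \<open>Commutation keeps the product self-adjoint; conjugation by \<open>u\<close> is
  multiplicative because u^2 = I.\<close>

lemma corner_compose:
  assumes A: "A \<in> \<K>" and B: "B \<in> \<K>" and comm: "A o\<^sub>L B = B o\<^sub>L A"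
  shows "A o\<^sub>L B \<in> \<K>"
proof -
  note [simp] = corner_applyD[OF A] corner_applyD[OF B]
  have "u o\<^sub>L (A o\<^sub>L B) o\<^sub>L u = (u o\<^sub>L A o\<^sub>L u) o\<^sub>L (u o\<^sub>L B o\<^sub>L u)"
    by (rule blinfun_eqI) simp
  moreover have "(A o\<^sub>L B) o\<^sub>L u o\<^sub>L e = e o\<^sub>L u o\<^sub>L (A o\<^sub>L B)"
    by (rule blinfun_eqI) (simp, metis corner_applyD[OF A] corner_applyD[OF B])
  ultimately show ?thesis
    using A B comm
    by (auto simp: corner_def selfadjoint_compose C_star_generated_compose intro: blinfun_eqI)
qed

text \<open>With c = e u e and f = u e u, c^2 = e f e and u c^2 u = f e f; both are words in the
  generators.\<close>

lemma compression_square_in_corner: "(e o\<^sub>L u o\<^sub>L e) o\<^sub>L (e o\<^sub>L u o\<^sub>L e) \<in> \<K>"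
proof -
  let ?f = "u o\<^sub>L e o\<^sub>L adj u"
  have in_C: "e \<in> \<C>" "?f \<in> \<C>"
    using C_star_generated_superset[of "{e, ?f}"] by auto
  have 1: "(e o\<^sub>L u o\<^sub>L e) o\<^sub>L (e o\<^sub>L u o\<^sub>L e) = e o\<^sub>L ?f o\<^sub>L e"
    and 2: "u o\<^sub>L ((e o\<^sub>L u o\<^sub>L e) o\<^sub>L (e o\<^sub>L u o\<^sub>L e)) o\<^sub>L u = ?f o\<^sub>L e o\<^sub>L ?f"
    by (auto simp: adj_u intro!: blinfun_eqI)
  have "selfadjoint ((e o\<^sub>L u o\<^sub>L e) o\<^sub>L (e o\<^sub>L u o\<^sub>L e))"
    by (intro selfadjoint_compose selfadjoint_conjugate self refl)
  moreover have "(e o\<^sub>L u o\<^sub>L e) o\<^sub>L (e o\<^sub>L u o\<^sub>L e) \<in> \<C>"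
      "u o\<^sub>L ((e o\<^sub>L u o\<^sub>L e) o\<^sub>L (e o\<^sub>L u o\<^sub>L e)) o\<^sub>L u \<in> \<C>"
    unfolding 2 unfolding 1 by (intro C_star_generated_compose in_C)+
  ultimately show ?thesis
    by (auto simp: corner_def intro: blinfun_eqI)
qed

text \<open>\<open>Y\<close> is \<open>e - (e - c\<^sup>2)\<^sup>1\<^sup>/\<^sup>2\<close>; the next lemma yields \<open>S = (e - Y)\<^sup>-\<^sup>1\<close>, the inverse square root.\<close>

lemma corner_fixpoint_sqrt:
  obtains Y where "Y \<in> \<K>" "norm Y \<le> r" "2 *\<^sub>R Y = ((e o\<^sub>L u o\<^sub>L e) o\<^sub>L (e o\<^sub>L u o\<^sub>L e)) + (Y o\<^sub>L Y)"
proof -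
  let ?c = "e o\<^sub>L u o\<^sub>L e"
  \<comment> \<open>In the corner the fixed points of \<open>?F\<close> are the solutions of (e -
    Y)^2 = e - c^2, where c = e u e.\<close>
  let ?s = "\<K> \<inter> cball 0 r" and ?F = "\<lambda>Y. (1/2) *\<^sub>R ((?c o\<^sub>L ?c) + (Y o\<^sub>L Y))"
  have "\<exists>!Y. Y \<in> ?s \<and> ?F Y = Y"
  proof (rule Banach_fix)
    show "complete ?s"
      by (intro closed_Int closed_corner closed_C_star_generated closed_cball
          complete_eq_closed[THEN iffD2])
    have "0 *\<^sub>R e \<in> \<K>" by (intro corner_scaleR e_in_corner)
    then show "?s \<noteq> {}" using r_bounds by force
    show "?F ` ?s \<subseteq> ?s"
    proof clarify
      fix Y assume Y: "Y \<in> \<K>" "Y \<in> cball 0 r"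
      have "norm ((?c o\<^sub>L ?c) + (Y o\<^sub>L Y)) \<le> norm ?c * norm ?c + norm Y * norm Y"
        by (rule order_trans[OF norm_triangle_ineq add_mono[OF norm_blinfun_compose norm_blinfun_compose]])
      also have "\<dots> \<le> (norm ?c)\<^sup>2 + r\<^sup>2"
        using Y r_bounds by (simp add: power2_eq_square mult_mono)
      finally have "norm (?F Y) \<le> r" using r_eq by simp
      then show "?F Y \<in> ?s"
        using Y by (auto intro!: corner_scaleR corner_add corner_compose compression_square_in_corner)
    qed
    show "dist (?F A) (?F B) \<le> r * dist A B" if "A \<in> ?s" "B \<in> ?s" for A B
    proof -
      have AB: "norm A \<le> r" "norm B \<le> r"
        using that by simp_all
      \<comment> \<open>This factorisation of A^2 - B^2 is valid for operators that do not
        commute.\<close>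
      have "?F A - ?F B = (1/2) *\<^sub>R ((A o\<^sub>L (A - B)) + ((A - B) o\<^sub>L B))"
        by (simp add: compose_simps algebra_simps)
      moreover have "norm ((A o\<^sub>L (A - B)) + ((A - B) o\<^sub>L B)) \<le> norm A * norm (A - B) + norm (A - B) * norm B"
        by (rule order_trans[OF norm_triangle_ineq add_mono[OF norm_blinfun_compose norm_blinfun_compose]])
      moreover have "\<dots> \<le> r * norm (A - B) + norm (A - B) * r"
        using AB r_bounds by (intro add_mono mult_mono) auto
      ultimately show ?thesis
        by (simp add: dist_norm)
    qed
  qed (use r_bounds in auto)
  then obtain Y where Y: "Y \<in> \<K>" "norm Y \<le> r" "?F Y = Y" by auto
  have "2 *\<^sub>R ?F Y = (?c o\<^sub>L ?c) + (Y o\<^sub>L Y)" by simp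
  then have "2 *\<^sub>R Y = (?c o\<^sub>L ?c) + (Y o\<^sub>L Y)" by (simp only: Y(3))
  with Y(1,2) show thesis by (rule that)
qed

lemma corner_fixpoint_inverse:
  assumes Y: "Y \<in> \<K>" "norm Y \<le> r"
  obtains S where "S \<in> \<K>" "S o\<^sub>L Y = Y o\<^sub>L S" "S = e + (Y o\<^sub>L S)"
proof -
  \<comment> \<open>The fixed point is the Neumann series of (e - Y)^-1 in the corner; carrying S Y
    = Y S along keeps Y S self-adjoint.\<close>
  let ?s = "\<K> \<inter> {S. S o\<^sub>L Y = Y o\<^sub>L S}" and ?F = "\<lambda>S. e + (Y o\<^sub>L S)"
  have eY: "e o\<^sub>L Y = Y" "Y o\<^sub>L e = Y"
    using Y by (auto simp: corner_def)
  have "\<exists>!S. S \<in> ?s \<and> ?F S = S"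
  proof (rule Banach_fix)
    show "complete ?s"
      by (intro closed_Int closed_corner closed_C_star_generated closed_Collect_eq
          continuous_intros complete_eq_closed[THEN iffD2])
    have "e \<in> ?s" using e_in_corner eY by simp
    then show "?s \<noteq> {}" by blast
    show "?F ` ?s \<subseteq> ?s"
    proof (rule image_subsetI)
      fix S assume "S \<in> ?s"
      then have S: "S \<in> \<K>" "S o\<^sub>L Y = Y o\<^sub>L S" by auto
      have "(Y o\<^sub>L S) o\<^sub>L Y = Y o\<^sub>L (Y o\<^sub>L S)"
        by (metis S(2) blinfun_compose_assoc)
      then show "?F S \<in> ?s"
        using Y S eY by (simp add: corner_add corner_compose e_in_corner compose_simps)
    qed
    show "dist (?F A) (?F B) \<le> r * dist A B" for A B
    proof -
      have "?F A - ?F B = Y o\<^sub>L (A - B)"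
        by (simp add: compose_simps)
      moreover have "norm (Y o\<^sub>L (A - B)) \<le> norm Y * norm (A - B)"
        by (rule norm_blinfun_compose)
      moreover have "\<dots> \<le> r * norm (A - B)"
        using Y by (intro mult_right_mono) auto
      ultimately show ?thesis
        by (simp add: dist_norm)
    qed
  qed (use r_bounds in auto)
  then obtain S where "S \<in> ?s" and S: "?F S = S"
    by (elim ex1E conjE)
  then have "S \<in> \<K>" "S o\<^sub>L Y = Y o\<^sub>L S" by simp_all
  then show thesis using S[symmetric] by (rule that)
qed

text \<open>With c = e u e and S = (e - c^2)^(-1/2) in the corner, g = S - u S u is a symmetry on
  the range of P = g^2 that anticommutes with \<open>u\<close>, and q = (P + g) / 2 projects onto
  its eigenspace for 1. The identities reduce to words in \<open>e\<close>, \<open>u\<close> and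
  \<open>S\<close>.\<close>

lemma nearest_projection:
  "\<exists>q\<in>Q_set u. q \<in> \<C> \<and> 2 * (norm (e - q))\<^sup>2 \<le> r"
proof -
  obtain Y where Y: "Y \<in> \<K>" "norm Y \<le> r"
    "2 *\<^sub>R Y = ((e o\<^sub>L u o\<^sub>L e) o\<^sub>L (e o\<^sub>L u o\<^sub>L e)) + (Y o\<^sub>L Y)"
    by (rule corner_fixpoint_sqrt)
  obtain S where S: "S \<in> \<K>" "S o\<^sub>L Y = Y o\<^sub>L S" "S = e + (Y o\<^sub>L S)"
    using corner_fixpoint_inverse[OF Y(1,2)] .
  note [simp] = corner_applyD[OF S(1)] and Ye = corner_applyD[OF Y(1)]
  have cinner_S: "cinner (S x) y = cinner x (S y)" and cinner_Y: "cinner (Y x) y = cinner x (Y y)" for x y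
    using S(1) Y(1) by (simp_all add: corner_def selfadjoint_def)
  have SY: "S (Y x) = Y (S x)" for x
    using S(2) by (metis blinfun_apply_blinfun_compose)
  have "S x = e x + Y (S x)" for x
    by (metis S(3) blinfun.add_left blinfun_apply_blinfun_compose)
  then have YS: "Y (S x) = S x - e x" for x
    by (metis add_diff_cancel_left')
  have YY: "2 *\<^sub>R Y x = e (u (e (u (e x)))) + Y (Y x)" for x
    using arg_cong[OF Y(3), of "\<lambda>A. A x"] by (simp add: blinfun.bilinear_simps)
  \<comment> \<open>That is, S^2 inverts e - c^2 in the corner; later computations with S^2 rest on
    this rule.\<close>
  have SS: "e (u (e (u (S (S x))))) = S (S x) - e x" for x
  proof -
    have "Y (Y (S (S x))) = S (S x) - 2 *\<^sub>R S x + e x"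
      by (simp add: YS blinfun.bilinear_simps scaleR_2)
    then show ?thesis
      using YY[of "S (S x)"] by (simp add: YS blinfun.bilinear_simps scaleR_2 algebra_simps)
  qed
  \<comment> \<open>This is e - Y = (e - c^2) S, which eliminates \<open>Y\<close> in favour of
    \<open>e\<close>, \<open>u\<close> and \<open>S\<close>.\<close>
  have Y_eq: "Y x = e x - S x + e (u (e (u (S x))))" for x
  proof -
    have "Y (Y (S x)) = Y (S x) - Y x"
      using arg_cong[OF YS[of x], of Y] by (simp only: blinfun.diff_right Ye)
    then have "2 *\<^sub>R Y (S x) = e (u (e (u (S x)))) + (Y (S x) - Y x)"
      using YY[of "S x"] by simp
    then have "Y x = e (u (e (u (S x)))) - Y (S x)"
      by (simp add: scaleR_2 algebra_simps)
    then show ?thesis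
      by (simp add: YS)
  qed
  \<comment> \<open>\<open>g\<close> is the sign of \<open>e - u e u\<close>, and \<open>P\<close> is the support projection.\<close>
  define g where "g = S - (u o\<^sub>L S o\<^sub>L u)"
  define P where "P = g o\<^sub>L g"
  define q where "q = (1/2) *\<^sub>R (P + g)"
  note apply_simps = blinfun.bilinear_simps
  have g: "g x = S x - u (S (u x))" for x
    by (simp add: g_def apply_simps)
  have P: "P x = g (g x)" for x
    by (simp add: P_def)
  have q: "q x = (1/2) *\<^sub>R (P x + g x)" for x
    by (simp add: q_def apply_simps)
  have ug: "u (g (u x)) = - g x" for x
    by (simp add: g apply_simps)
  \<comment> \<open>Expanding g^2 e leaves S^2 - c^2 S^2 = e. As \<open>P\<close> also commutes with
    \<open>u\<close>, it fixes the range of u e u too, whence P g = g.\<close>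
  have Pe: "P (e x) = e x" for x
    by (simp add: P g apply_simps SS)
  have Pu: "P (u x) = u (P x)" for x
    by (metis P ug uu blinfun.minus_right minus_minus)
  have PS: "P (S x) = S x" for x
    by (metis Pe corner_applyD(1)[OF S(1)])
  have Pg: "P (g x) = g x" for x
    by (simp add: g apply_simps PS Pu)
  have self_g: "selfadjoint g"
    unfolding g_def using S(1) self(2)
    by (auto simp: corner_def intro!: selfadjoint_minus selfadjoint_conjugate)
  have self_q: "selfadjoint q"
    unfolding q_def P_def
    by (intro selfadjoint_scaleR selfadjoint_add selfadjoint_compose self_g refl)
  have gP: "g (P x) = g x" for x
    using Pg by (simp add: P)
  have gg: "g (g x) = P x" for x
    by (simp add: P)
  have PP: "P (P x) = P x" for x
    by (metis P Pg)
  have qq: "q (q x) = q x" for x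
    by (simp add: q apply_simps gP Pg PP gg algebra_simps)
      (simp add: scaleR_2[symmetric] flip: scaleR_add_left)
  have quq: "q (u (q x)) = 0" for x
  proof -
    \<comment> \<open>Since u q u = (P - g) / 2, this is (P + g)(P - g) / 4 = 0.\<close>
    have "q (u (q (u y))) = 0" for y
      by (simp add: q apply_simps Pu ug gP Pg PP gg)
    then show ?thesis by (metis uu)
  qed
  have "g \<in> \<C>"
    unfolding g_def using S(1) by (auto simp: corner_def intro: C_star_generated_diff)
  then have "q \<in> \<C>"
    unfolding q_def P_def
    by (intro C_star_generated_scaleR C_star_generated_add C_star_generated_compose)
  moreover have "q \<in> Q_set u"
    using self_q by (auto simp: Q_set_def orthogonal_projection_def selfadjoint_iff_adj qq quq
        intro!: blinfun_eqI)
  moreover have "2 * (norm (e - q))\<^sup>2 \<le> r"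
  proof -
    \<comment> \<open>\<open>W\<close> is a partial isometry from the range of \<open>e\<close> onto that of \<open>P - e\<close>, with adjoint \<open>W'\<close>; it splits
      \<open>(e - q)\<^sup>2\<close> into two orthogonal copies of \<open>Y / 2\<close>.\<close>
    define W where "W x = P (u (S x)) - e (u (S x))" for x
    define W' where "W' x = S (u (P x)) - S (u (e x))" for x
    have P_eq: "P x = e x + W (W' x)" for x
      by (simp add: W_def W'_def P g apply_simps SS)
    have M_eq: "(e - q) ((e - q) x) = (1/2) *\<^sub>R (Y x + W (Y (W' x)))" for x
    proof -
      have q2: "2 *\<^sub>R q z = P z + g z" for z
        by (simp add: q)
      have "2 *\<^sub>R (e - q) ((e - q) x) = 2 *\<^sub>R e x - e (2 *\<^sub>R q x) - 2 *\<^sub>R q (e x) + 2 *\<^sub>R q x"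
        by (simp add: apply_simps qq algebra_simps)
      also have "\<dots> = Y x + W (Y (W' x))"
        unfolding q2 W_def W'_def Y_eq by (simp add: P g apply_simps SS scaleR_2)
      finally have "(1/2) *\<^sub>R (2 *\<^sub>R (e - q) ((e - q) x)) = (1/2) *\<^sub>R (Y x + W (Y (W' x)))"
        by simp
      then show ?thesis by simp
    qed
    have cinner_P: "cinner (P x) y = cinner x (P y)" for x y
      using self_g by (simp add: selfadjoint_def P)
    have W_adj: "cinner (W x) y = cinner x (W' y)" for x y
      by (simp add: W_def W'_def cinner_diff_left cinner_diff_right cinner_P cinner_u cinner_S cinner_e)
    have Yr: "Re (cinner (Y x) x) \<le> r * (norm x)\<^sup>2" for x
    proof -
      have "Re (cinner (Y x) x) \<le> norm (Y x) * norm x" by (rule Re_cinner_le)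
      also have "\<dots> \<le> (r * norm x) * norm x"
        by (intro mult_right_mono order_trans[OF norm_blinfun mult_right_mono[OF Y(2)]]) simp_all
      finally show ?thesis by (simp add: power2_eq_square mult_ac)
    qed
    have "norm (e - q) \<le> sqrt (r / 2)"
    proof (rule norm_blinfun_bound)
      fix x
      have Pn: "Re (cinner (P x) x) \<le> (norm x)\<^sup>2"
      proof -
        have "(norm (P x))\<^sup>2 = Re (cinner (P x) x)"
          by (simp add: Re_cinner_self[symmetric] cinner_P PP)
        moreover have *: "Re (cinner (P x) x) \<le> norm (P x) * norm x" by (rule Re_cinner_le)
        ultimately have "norm (P x) \<le> norm x"
          by (cases "P x = 0")
            (auto simp: power2_eq_square intro: mult_left_le_imp_le[of "norm (P x)"])
        then have "norm (P x) * norm x \<le> (norm x)\<^sup>2"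
          by (simp add: power2_eq_square mult_right_mono)
        with * show ?thesis by linarith
      qed
      have "(norm ((e - q) x))\<^sup>2 = Re (cinner ((e - q) ((e - q) x)) x)"
        using selfadjoint_minus[OF self(1) self_q] by (simp add: selfadjoint_def cinner_self)
      \<comment> \<open>Bounding at \<open>e x\<close> and \<open>W' x\<close> separately keeps the
        constant sharp: as P = e + W W', the numbers |e x|^2 and |W' x|^2 add up to <P x, x> <=
        |x|^2.\<close>
      also have "\<dots> = (Re (cinner (Y (e x)) (e x)) + Re (cinner (Y (W' x)) (W' x))) / 2"
      proof -
        have "cinner (Y (e x)) (e x) = cinner (Y x) x"
          by (simp only: cinner_e[symmetric] Ye(1,2))
        then show ?thesis
          by (simp add: M_eq cinner_scaleR_left cinner_add_left W_adj)
      qed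
      also have "\<dots> \<le> (r * (norm (e x))\<^sup>2 + r * (norm (W' x))\<^sup>2) / 2"
        using Yr[of "e x"] Yr[of "W' x"] by simp
      also have "\<dots> = r * Re (cinner (P x) x) / 2"
      proof -
        have "Re (cinner (P x) x) = (norm (e x))\<^sup>2 + (norm (W' x))\<^sup>2"
          by (simp add: P_eq cinner_add_left W_adj Re_cinner_self[symmetric] cinner_e)
        then show ?thesis
          by (simp add: distrib_left)
      qed
      also have "\<dots> \<le> r * (norm x)\<^sup>2 / 2"
        using Pn r_bounds by (simp add: mult_left_mono)
      finally have "(norm ((e - q) x))\<^sup>2 \<le> (sqrt (r / 2) * norm x)\<^sup>2"
        using r_bounds by (simp add: power_mult_distrib)
      then show "norm ((e - q) x) \<le> sqrt (r / 2) * norm x"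
        by (rule power2_le_imp_le) (use r_bounds in simp)
    qed (use r_bounds in simp)
    then have "(norm (e - q))\<^sup>2 \<le> (sqrt (r / 2))\<^sup>2"
      by (intro power_mono) auto
    then show ?thesis using r_bounds by simp
  qed
  ultimately show ?thesis by blast
qed

text \<open>Solves the compression bound |e u e|^2 <= 1 - (1 - 2 d^2)^2 for d = |e - q| when 2 d^2
  <= 1; otherwise r < 1 < 2 d^2.\<close>

lemma distance_lower_bound:
  assumes "q \<in> Q_set u"
  shows "r \<le> 2 * (norm (e - q))\<^sup>2"
proof (cases "2 * (norm (e - q))\<^sup>2 \<le> 1")
  case True
  have q: "selfadjoint q" "q (q x) = q x" "q (u (q x)) = 0" for x
  proof -
    have q: "q \<in> BH" "adj q = q" "q o\<^sub>L q = q" "q o\<^sub>L u o\<^sub>L q = 0"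
      using assms by (simp_all add: Q_set_def orthogonal_projection_def)
    then show "selfadjoint q" by (simp add: selfadjoint_iff_adj)
    show "q (q x) = q x" "q (u (q x)) = 0"
      by (metis q(3) blinfun_apply_blinfun_compose,
          metis q(4) blinfun_apply_blinfun_compose blinfun.zero_left)
  qed
  have "norm e \<le> 1"
  proof (rule norm_blinfun_bound)
    fix x
    have "(norm (e x))\<^sup>2 = Re (cinner (e x) x)"
      by (simp add: Re_cinner_self[symmetric] cinner_e)
    also have "\<dots> \<le> norm (e x) * norm x" by (rule Re_cinner_le)
    finally show "norm (e x) \<le> 1 * norm x"
      by (cases "e x = 0") (simp_all add: power2_eq_square)
  qed simp
  then have "(norm (e o\<^sub>L u o\<^sub>L e))\<^sup>2 \<le> 1 - (1 - 2 * (norm (e - q))\<^sup>2)\<^sup>2"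
    using self q True by (intro norm_compression_le) auto
  then have "1 - 2 * (norm (e - q))\<^sup>2 \<le> sqrt (1 - (norm (e o\<^sub>L u o\<^sub>L e))\<^sup>2)"
    by (intro real_le_rsqrt) simp
  then show ?thesis by (simp add: r_def)
next
  case False
  then show ?thesis using r_bounds by simp
qed

end

theorem mainTheorem2:
  fixes e u :: "'a::chilbert_space \<Rightarrow>\<^sub>L 'a"
  assumes "orthogonal_projection e"
    and "hermitian_involution u"
    and "norm (e o\<^sub>L u o\<^sub>L e) < 1"
  shows "\<exists>q0 \<in> Q_set u \<inter> W_star_generated {e, u}.
    q0 \<in> C_star_generated {e, u o\<^sub>L e o\<^sub>L adj u} \<and>
    norm (e - q0) = (INF q \<in> Q_set u \<inter> W_star_generated {e, u}. norm (e - q))"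
proof -
  interpret acute_projection e u
    using assms by unfold_locales
  obtain q0 where q0: "q0 \<in> Q_set u" "q0 \<in> \<C>" "2 * (norm (e - q0))\<^sup>2 \<le> r"
    using nearest_projection by blast
  have in_W: "q0 \<in> W_star_generated {e, u}"
    using C_star_generated_subset_W_star_generated[OF adj_u] q0(2) by blast
  \<comment> \<open>The upper bound at \<open>q0\<close> and the lower bound at \<open>q\<close>
    meet in \<open>r\<close>.\<close>
  have "norm (e - q0) \<le> norm (e - q)" if "q \<in> Q_set u" for q
  proof (rule power2_le_imp_le)
    show "(norm (e - q0))\<^sup>2 \<le> (norm (e - q))\<^sup>2"
      using q0(3) distance_lower_bound[OF that] by linarith
  qed simp
  then have "(INF q \<in> Q_set u \<inter> W_star_generated {e, u}. norm (e - q)) = norm (e - q0)"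
    using q0(1) in_W by (intro cInf_eq_minimum) auto
  then show ?thesis
    using q0(1,2) in_W by (intro bexI[of _ q0] conjI IntI) simp_all
qed

end
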